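(* Let $\alpha>0$ and assume that the operator $\mathcal F_\alpha$ is restricted monotone with respect to $\operatorname{zer}(\mathcal A_\alpha)$. Then, for any initial condition $\boldsymbol x^0\in\mathbb R^{Nn}$, the sequence $(\boldsymbol x^k)_{k\in\mathbb N}$ generated by the following iteration with this $\alpha$: for all $k\in\mathbb N$ and all $i\in\mathcal I$, $$\tilde{\boldsymbol x}_i^k=\tfrac12\Big(\boldsymbol x_i^k+\sum_{j=1}^N w_{i,j}\boldsymbol x_j^k\Big),\qquad \boldsymbol x_{i,-i}^{k+1}=\tilde{\boldsymbol x}_{i,-i}^k,\qquad \boldsymbol x_{i,i}^{k+1}=x_i^{k+1}=\operatorname*{argmin}_{y\in\mathcal X_i}\Big(f_i(y,\tilde{\boldsymbol x}_{i,-i}^k)+\tfrac1\alpha\|y-\tilde{\boldsymbol x}_{i,i}^k\|^2\Big),$$ converges to a point $\boldsymbol x^\star=\boldsymbol 1_N\otimes x^\star$, where $x^\star$ is a Nash equilibrium of the game.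
   Context: Game. $\mathcal I=\{1,\dots,N\}$ is a set of agents; agent $i$ has strategy $x_i\in\mathcal X_i\subseteq\mathbb R^{n_i}$; $n=\sum_i n_i$, $\mathcal X=\mathcal X_1\times\dots\times\mathcal X_N\subseteq\mathbb R^n$, $x=\operatorname{col}((x_i)_{i\in\mathcal I})$ (stacked vector), $x_{-i}=\operatorname{col}((x_j)_{j\ne i})$. Agent $i$ has cost $f_i:\mathbb R^n\to\mathbb R$, written $f_i(x_i,x_{-i})$. A Nash equilibrium is $x^\star\in\mathcal X$ with $x_i^\star\in\operatorname{argmin}_{y\in\mathcal X_i}f_i(y,x_{-i}^\star)$ for all $i\in\mathcal I$. Assumptions. (Convexity) For each $i$, $\mathcal X_i$ is nonempty, closed and convex; $f_i$ is continuous and $f_i(\cdot,x_{-i})$ is convex for every $x_{-i}$. (Existence) The game has at least one Nash equilibrium. (Connectivity) The agents communicate over an undirected connected graph $\mathcal G(\mathcal I,\mathcal E)$ with weight matrix $W\in\mathbb R^{N\times N}$, $w_{i,j}=[W]_{i,j}$, where for $i\neq j$, $w_{i,j}>0$ if $(i,j)\in\mathcal E$ and $w_{i,j}=0$ otherwise, and $W=W^\top$, $w_{i,i}>0$ for all $i$, $W\boldsymbol 1_N=\boldsymbol 1_N$, $\boldsymbol 1_N^\top W=\boldsymbol 1_N^\top$. Estimates. $\boldsymbol x_i=\operatorname{col}((\boldsymbol x_{i,j})_{j\in\mathcal I})\in\mathbb R^n$, where $\boldsymbol x_{i,i}=x_i\in\mathbb R^{n_i}$ is agent $i$'s strategy and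 $\boldsymbol x_{i,j}\in\mathbb R^{n_j}$ is agent $i$'s estimate of agent $j$'s strategy; $\boldsymbol x_{i,-i}=\operatorname{col}((\boldsymbol x_{i,j})_{j\ne i})$; $\boldsymbol x=\operatorname{col}((\boldsymbol x_i)_{i\in\mathcal I})\in\mathbb R^{Nn}$. The same block notation is used for $\tilde{\boldsymbol x}_i$. $\mathcal R_i\in\mathbb R^{n_i\times n}$ is the matrix selecting the $i$-th block (of dimension $n_i$) of a vector in $\mathbb R^n$, and $\mathcal R=\operatorname{diag}((\mathcal R_i)_{i\in\mathcal I})\in\mathbb R^{n\times Nn}$, so $\mathcal R\boldsymbol x=\operatorname{col}((x_i)_{i})$. Operators. $\partial_{x_i}f_i$ is the convex subdifferential with respect to the own strategy. The extended game mapping is the (possibly set-valued) operator $\boldsymbol F(\boldsymbol x)=\operatorname{col}((\partial_{x_i}f_i(x_i,\boldsymbol x_{i,-i}))_{i\in\mathcal I})$ (product of the subdifferential sets). With $\boldsymbol W=W\otimes I_n$ and $\boldsymbol{\mathcal X}=\{\boldsymbol x\in\mathbb R^{Nn}\mid\mathcal R\boldsymbol x\in\mathcal X\}$, $$\mathcal F_\alpha(\boldsymbol x)=\alpha\mathcal R^\top\boldsymbol F(\boldsymbol x)+(I_{Nn}-\boldsymbol W)\boldsymbol x,\qquad \mathcal A_\alpha(\boldsymbol x)=\mathcal F_\alpha(\boldsymbol x)+\mathrm N_{\boldsymbol{\mathcal X}}(\boldsymbol x),$$ where $\mathrm N_S$ is the normal cone of $S$ (empty outside $S$). $\operatorname{zer}(\mathcal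 A_\alpha)=\{\boldsymbol x\mid 0\in\mathcal A_\alpha(\boldsymbol x)\}$. Restricted monotonicity. A set-valued operator $\mathcal F:\mathbb R^q\rightrightarrows\mathbb R^q$ is restricted monotone with respect to a set $\Sigma\ne\varnothing$ if $\langle x-x^\star,u-u^\star\rangle\ge0$ for all $(x,u),(x^\star,u^\star)$ in the graph of $\mathcal F$ with $x^\star\in\Sigma$. *)

theory Defs
  imports "HOL-Analysis.Analysis"
begin

text \<open>
  Agents are the elements of a finite type 'i and the coordinates of the joint strategy space are
  the elements of a finite type 'd, so that N = CARD('i) and n = CARD('d). A map own from
  coordinates to agents says which agent controls which coordinate: agent i has dimension
  n_i = card {c. own c = i}. As own is arbitrary, the dimensions may differ between agents.
  The space of the strategies of agent i is represented by the subspace of vectors that vanish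
  outside the coordinates of agent i, with the inner product, norm and topology of the ambient
  space. A vector of estimates is an element x of (real ^ 'd) ^ 'i, whose component x $ i
  collects the estimates of agent i; the inner product on this type is the one of the stacked
  vector of dimension N * n.
\<close>

definition strategy_space :: "('d \<Rightarrow> 'i) \<Rightarrow> 'i \<Rightarrow> (real ^ 'd) set" where
  "strategy_space own i = {y. \<forall>c. own c \<noteq> i \<longrightarrow> y $ c = 0}"

definition block :: "('d \<Rightarrow> 'i) \<Rightarrow> 'i \<Rightarrow> real ^ 'd \<Rightarrow> real ^ 'd" where
  "block own i z = (\<chi> c. if own c = i then z $ c else 0)"

text \<open>replace_block own i y z is the vector written (y, z_{-i}) on paper.\<close>

definition replace_block :: "('d \<Rightarrow> 'i) \<Rightarrow> 'i \<Rightarrow> real ^ 'd \<Rightarrow> real ^ 'd \<Rightarrow> real ^ 'd" where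
  "replace_block own i y z = (\<chi> c. if own c = i then y $ c else z $ c)"

definition joint_strategies :: "('d \<Rightarrow> 'i) \<Rightarrow> ('i \<Rightarrow> (real ^ 'd) set) \<Rightarrow> (real ^ 'd) set" where
  "joint_strategies own X = {x. \<forall>i. block own i x \<in> X i}"

definition nash_equilibrium ::
  "('d \<Rightarrow> 'i) \<Rightarrow> ('i \<Rightarrow> (real ^ 'd) set) \<Rightarrow> ('i \<Rightarrow> real ^ 'd \<Rightarrow> real) \<Rightarrow> real ^ 'd \<Rightarrow> bool" where
  "nash_equilibrium own X f x \<longleftrightarrow> x \<in> joint_strategies own X \<and>
     (\<forall>i. is_arg_min (\<lambda>y. f i (replace_block own i y x)) (\<lambda>y. y \<in> X i) (block own i x))"

text \<open>Convex subdifferential of a function considered on the linear subspace V.\<close>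

definition subdifferential_on :: "'a::real_inner set \<Rightarrow> ('a \<Rightarrow> real) \<Rightarrow> 'a \<Rightarrow> 'a set" where
  "subdifferential_on V h x = {g \<in> V. \<forall>y\<in>V. h y \<ge> h x + g \<bullet> (y - x)}"

definition normal_cone :: "'a::real_inner set \<Rightarrow> 'a \<Rightarrow> 'a set" where
  "normal_cone S x = (if x \<in> S then {v. \<forall>y\<in>S. v \<bullet> (y - x) \<le> 0} else {})"

text \<open>
  The side condition that S is nonempty is not part of this definition. For S empty the property
  is vacuously true, so a theorem that assumes it for S is not weakened by the omission.
\<close>

definition restricted_monotone :: "('a::real_inner \<Rightarrow> 'a set) \<Rightarrow> 'a set \<Rightarrow> bool" where
  "restricted_monotone T S \<longleftrightarrow>
     (\<forall>x. \<forall>u\<in>T x. \<forall>x'\<in>S. \<forall>u'\<in>T x'. (x - x') \<bullet> (u - u') \<ge> 0)"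

definition zer :: "('a \<Rightarrow> 'b::zero set) \<Rightarrow> 'a set" where
  "zer T = {x. 0 \<in> T x}"

text \<open>The matrix R that selects from the estimates of each agent its own strategy, and its transpose.\<close>

definition sel :: "('d \<Rightarrow> 'i) \<Rightarrow> (real ^ 'd) ^ 'i \<Rightarrow> real ^ 'd" where
  "sel own x = (\<chi> c. x $ own c $ c)"

definition sel_transpose :: "('d \<Rightarrow> 'i) \<Rightarrow> real ^ 'd \<Rightarrow> (real ^ 'd) ^ 'i" where
  "sel_transpose own u = (\<chi> i. block own i u)"

lemma adjoint_sel: "adjoint (sel own) = sel_transpose (own :: 'd::finite \<Rightarrow> 'i::finite)"
proof (rule adjoint_unique, intro allI)
  fix x :: "(real ^ 'd) ^ 'i" and u :: "real ^ 'd"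
  have "x \<bullet> sel_transpose own u = (\<Sum>i\<in>UNIV. \<Sum>c\<in>UNIV. if own c = i then x $ i $ c * u $ c else 0)"
    unfolding inner_vec_def sel_transpose_def block_def
    by (intro sum.cong) auto
  also have "\<dots> = (\<Sum>c\<in>UNIV. \<Sum>i\<in>UNIV. if own c = i then x $ i $ c * u $ c else 0)"
    by (rule sum.swap)
  also have "\<dots> = sel own x \<bullet> u"
    by (simp add: inner_vec_def sel_def)
  finally show "sel own x \<bullet> u = x \<bullet> sel_transpose own u" by simp
qed

text \<open>The action of the Kronecker product of W with the identity matrix of size n.\<close>

definition mix :: "real ^ 'i ^ 'i \<Rightarrow> (real ^ 'd) ^ 'i \<Rightarrow> (real ^ 'd) ^ 'i" where
  "mix W x = (\<chi> i. \<Sum>j\<in>UNIV. W $ i $ j *\<^sub>R x $ j)"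

definition extended_game_map ::
  "('d \<Rightarrow> 'i) \<Rightarrow> ('i \<Rightarrow> real ^ 'd \<Rightarrow> real) \<Rightarrow> (real ^ 'd) ^ 'i \<Rightarrow> (real ^ 'd) set" where
  "extended_game_map own f x =
     {u. \<forall>i. block own i u \<in>
        subdifferential_on (strategy_space own i)
          (\<lambda>y. f i (replace_block own i y (x $ i))) (block own i (x $ i))}"

definition extended_feasible ::
  "('d \<Rightarrow> 'i) \<Rightarrow> ('i \<Rightarrow> (real ^ 'd) set) \<Rightarrow> ((real ^ 'd) ^ 'i) set" where
  "extended_feasible own X = {x. sel own x \<in> joint_strategies own X}"

definition F_op ::
  "('d \<Rightarrow> 'i) \<Rightarrow> ('i \<Rightarrow> real ^ 'd \<Rightarrow> real) \<Rightarrow> real ^ 'i ^ 'i \<Rightarrow> real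
     \<Rightarrow> (real ^ 'd) ^ 'i \<Rightarrow> ((real ^ 'd) ^ 'i) set" where
  "F_op own f W \<alpha> x =
     {\<alpha> *\<^sub>R sel_transpose own u + (x - mix W x) | u. u \<in> extended_game_map own f x}"

definition A_op ::
  "('d \<Rightarrow> 'i) \<Rightarrow> ('i \<Rightarrow> (real ^ 'd) set) \<Rightarrow> ('i \<Rightarrow> real ^ 'd \<Rightarrow> real) \<Rightarrow> real ^ 'i ^ 'i \<Rightarrow> real
     \<Rightarrow> (real ^ 'd) ^ 'i \<Rightarrow> ((real ^ 'd) ^ 'i) set" where
  "A_op own X f W \<alpha> x =
     {a + v | a v. a \<in> F_op own f W \<alpha> x \<and> v \<in> normal_cone (extended_feasible own X) x}"

definition averaged_estimates :: "real ^ 'i ^ 'i \<Rightarrow> (real ^ 'd) ^ 'i \<Rightarrow> (real ^ 'd) ^ 'i" where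
  "averaged_estimates W x = (\<chi> i. (1/2) *\<^sub>R (x $ i + (\<Sum>j\<in>UNIV. W $ i $ j *\<^sub>R x $ j)))"

text \<open>
  One step of the iteration. The objective is strongly convex and continuous on the nonempty
  closed convex set X i, so arg_min denotes its unique minimizer.
\<close>

definition nash_step ::
  "('d \<Rightarrow> 'i) \<Rightarrow> ('i \<Rightarrow> (real ^ 'd) set) \<Rightarrow> ('i \<Rightarrow> real ^ 'd \<Rightarrow> real) \<Rightarrow> real ^ 'i ^ 'i \<Rightarrow> real
     \<Rightarrow> (real ^ 'd) ^ 'i \<Rightarrow> (real ^ 'd) ^ 'i" where
  "nash_step own X f W \<alpha> x =
     (let z = averaged_estimates W x in
      \<chi> i. replace_block own i
             (arg_min
                (\<lambda>y. f i (replace_block own i y (z $ i)) + (1/\<alpha>) * (norm (y - block own i (z $ i)))\<^sup>2)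
                (\<lambda>y. y \<in> X i))
             (z $ i))"

definition undirected_connected :: "('i \<times> 'i) set \<Rightarrow> bool" where
  "undirected_connected E \<longleftrightarrow> sym E \<and> (\<forall>i j. (i, j) \<in> E\<^sup>*)"

text \<open>In the last two equations 1 is the vector with all entries equal to one.\<close>

definition weight_matrix :: "('i \<times> 'i) set \<Rightarrow> real ^ 'i ^ 'i \<Rightarrow> bool" where
  "weight_matrix E W \<longleftrightarrow>
     (\<forall>i j. i \<noteq> j \<longrightarrow> (if (i, j) \<in> E then W $ i $ j > 0 else W $ i $ j = 0)) \<and>
     W = transpose W \<and> (\<forall>i. W $ i $ i > 0) \<and> W *v 1 = 1 \<and> 1 v* W = 1"

end

theory Submission
  imports Defs
begin

text \<open>
  The optimality condition of the minimization in one step reads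
  \<open>(I + W) (x\<^sup>k - x\<^sup>k\<^sup>+\<^sup>1) \<in> A (x\<^sup>k\<^sup>+\<^sup>1)\<close>, so the iteration is a proximal-point method for the
  operator \<open>A\<close> that is preconditioned by \<open>I + W\<close>. Since the diagonal of \<open>W\<close> is positive, \<open>I + W\<close> is
  positive definite, and restricted monotonicity makes the iterates Fejer monotone with respect to
  the zeros of \<open>A\<close> in the norm that it induces. Best responses depend on the estimates through a
  closed relation, so every cluster point is a fixed point and hence a zero of \<open>A\<close>; Fejer
  monotonicity then yields convergence of the whole sequence. Finally, summing the inclusion
  \<open>0 \<in> A x\<close> over the agents separates its consensus part from its game part, which shows that the
  zeros of \<open>A\<close> are exactly the consensual Nash equilibria.
\<close>

section \<open>Convex minimization\<close>

text \<open>The hyperplane separating the strict epigraph of \<open>h - h p\<close> from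
  \<open>C \<times> {..0}\<close> is not vertical, because \<open>h\<close> is finite on the whole
  space. Its slope is a subgradient of \<open>h\<close> at \<open>p\<close> whose negative is normal
  to \<open>C\<close> at \<open>p\<close>.\<close>

lemma convex_minimizer_subgradient:
  fixes h :: "'a::euclidean_space \<Rightarrow> real"
  assumes h: "convex_on UNIV h" and C: "convex C" and p: "p \<in> C"
    and min: "\<And>y. y \<in> C \<Longrightarrow> h p \<le> h y"
  obtains g where "\<And>y. h y \<ge> h p + g \<bullet> (y - p)" "\<And>y. y \<in> C \<Longrightarrow> g \<bullet> (y - p) \<ge> 0"
proof -
  define A where "A = {(y, t). t > h y - h p}"
  define B where "B = C \<times> {..0::real}"
  have "convex A"
    unfolding convex_def
  proof (intro ballI allI impI)
    fix a b :: "'a \<times> real" and u v :: real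
    assume a: "a \<in> A" and b: "b \<in> A" and uv: "0 \<le> u" "0 \<le> v" "u + v = 1"
    obtain y s where a_eq: "a = (y, s)" by (cases a)
    obtain z t where b_eq: "b = (z, t)" by (cases b)
    have s: "s > h y - h p" and t: "t > h z - h p"
      using a b by (auto simp: A_def a_eq b_eq)
    have "h (u *\<^sub>R y + v *\<^sub>R z) \<le> u * h y + v * h z"
      using h uv by (simp add: convex_on_def)
    moreover have "u * s + v * t > u * (h y - h p) + v * (h z - h p)"
    proof (cases "u = 0")
      case True
      with uv t show ?thesis by simp
    next
      case False
      with uv s t show ?thesis
        by (intro add_less_le_mono mult_strict_left_mono mult_left_mono) auto
    qed
    moreover have "u * h p + v * h p = h p"
      using uv by (metis distrib_right mult_1)
    ultimately show "u *\<^sub>R a + v *\<^sub>R b \<in> A"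
      by (simp add: A_def a_eq b_eq algebra_simps)
  qed
  moreover have "convex B"
    unfolding B_def by (intro convex_Times C) simp
  moreover have "A \<noteq> {}" "B \<noteq> {}"
    using p by (auto simp: A_def B_def intro: gt_ex)
  moreover have "A \<inter> B = {}"
    using min by (force simp: A_def B_def)
  ultimately obtain ab \<beta> where ab: "ab \<noteq> 0" "\<forall>x\<in>B. ab \<bullet> x \<le> \<beta>" "\<forall>x\<in>A. ab \<bullet> x \<ge> \<beta>"
    using separating_hyperplane_sets[of B A] by (metis inf_commute)
  obtain a b where ab_eq: "ab = (a, b)" by (cases ab)
  have upper: "a \<bullet> y + b * t \<ge> \<beta>" if "t > h y - h p" for y t
    using ab(3) that by (force simp: A_def ab_eq)
  have lower: "a \<bullet> y \<le> \<beta>" if "y \<in> C" for y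
    using ab(2) that by (force simp: B_def ab_eq)
  have "b \<ge> 0"
  proof (rule ccontr)
    assume "\<not> b \<ge> 0"
    then have b: "b < 0" by simp
    \<comment> \<open>The quotient is the height at which the functional over \<open>p\<close>
      equals \<open>\<beta> - 1\<close>; the maximum with 1 keeps \<open>(p, t)\<close> inside
      \<open>A\<close>.\<close>
    define t where "t = max 1 ((\<beta> - a \<bullet> p - 1) / b)"
    have "b * t \<le> b * ((\<beta> - a \<bullet> p - 1) / b)"
      using b by (intro mult_left_mono_neg) (auto simp: t_def)
    then have "b * t \<le> \<beta> - a \<bullet> p - 1"
      using b by simp
    moreover have "a \<bullet> p + b * t \<ge> \<beta>"
      by (rule upper) (simp add: t_def)
    ultimately show False by simp
  qed
  \<comment> \<open>A vertical hyperplane would bound the linear functional \<open>a\<close> below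
    on the whole space by a value it does not exceed at \<open>p\<close>; testing at
    \<open>p - a\<close> gives \<open>a = 0\<close>.\<close>
  moreover have "b \<noteq> 0"
  proof
    assume b: "b = 0"
    have all: "a \<bullet> y \<ge> \<beta>" for y
      using upper[of y "h y - h p + 1"] b by simp
    have "a \<bullet> (p - a) \<ge> a \<bullet> p"
      using all[of "p - a"] lower[OF p] by simp
    then have "a \<bullet> a \<le> 0"
      by (simp add: inner_diff_right)
    then have "a = 0"
      by (metis inner_eq_zero_iff inner_ge_zero order_antisym)
    with b ab(1) show False by (simp add: ab_eq zero_prod_def)
  qed
  ultimately have b: "b > 0" by simp
  \<comment> \<open>The bound passes to the boundary of the epigraph: rising above the graph by
    \<open>e / b\<close> costs exactly \<open>e\<close>.\<close>
  have sup: "a \<bullet> y + b * (h y - h p) \<ge> \<beta>" for y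
  proof (rule field_le_epsilon)
    fix e :: real assume "e > 0"
    then have "a \<bullet> y + b * (h y - h p + e / b) \<ge> \<beta>"
      using b by (intro upper) simp
    then show "\<beta> \<le> a \<bullet> y + b * (h y - h p) + e"
      using b by (simp add: distrib_left)
  qed
  have \<beta>: "a \<bullet> p = \<beta>"
    using sup[of p] lower[OF p] by simp
  show thesis
  proof (rule that[of "- (1 / b) *\<^sub>R a"])
    fix y
    have "a \<bullet> p - a \<bullet> y \<le> b * (h y - h p)"
      using sup[of y] \<beta> by simp
    then have "(a \<bullet> p - a \<bullet> y) / b \<le> h y - h p"
      using b by (simp add: divide_le_eq mult.commute)
    then show "h y \<ge> h p + (- (1 / b) *\<^sub>R a) \<bullet> (y - p)"
      by (simp add: inner_diff_right diff_divide_distrib)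
  next
    fix y assume "y \<in> C"
    then show "(- (1 / b) *\<^sub>R a) \<bullet> (y - p) \<ge> 0"
      using lower[of y] \<beta> b by (simp add: inner_diff_right divide_right_mono)
  qed
qed

text \<open>Along segments in \<open>C\<close> the quadratic differs from its linearization at
  \<open>p\<close> only to second order. Hence \<open>p\<close> also minimizes \<open>h\<close> plus
  the linear form given by the gradient \<open>c\<close> of the quadratic, and subtracting
  \<open>c\<close> from a subgradient of that sum gives one of \<open>h\<close>.\<close>

lemma proximal_minimizer_subgradient:
  fixes h :: "'a::euclidean_space \<Rightarrow> real"
  assumes h: "convex_on UNIV h" and C: "convex C" and p: "p \<in> C"
    and min: "\<And>y. y \<in> C \<Longrightarrow> h p + r * (norm (p - q))\<^sup>2 \<le> h y + r * (norm (y - q))\<^sup>2"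
  obtains g where "\<And>y. h y \<ge> h p + g \<bullet> (y - p)"
    "\<And>y. y \<in> C \<Longrightarrow> (g + (2 * r) *\<^sub>R (p - q)) \<bullet> (y - p) \<ge> 0"
proof -
  define c where "c = (2 * r) *\<^sub>R (p - q)"
  have lin: "h p + c \<bullet> p \<le> h y + c \<bullet> y" if y: "y \<in> C" for y
  proof -
    define s where "s = h y - h p + c \<bullet> (y - p)"
    \<comment> \<open>This compares \<open>p\<close> with the point at parameter \<open>t\<close> on
      the segment towards \<open>y\<close> and divides by \<open>t\<close>. The remainder keeps a
      factor \<open>t\<close> and disappears in the limit \<open>t\<close> to 0.\<close>
    have "0 \<le> s + t * (r * (norm (y - p))\<^sup>2)" if t: "0 < t" "t < 1" for t
    proof -
      have conv: "(1 - t) *\<^sub>R p + t *\<^sub>R y \<in> C"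
        using C p y t by (simp add: convex_def)
      have eq: "(1 - t) *\<^sub>R p + t *\<^sub>R y - q = (p - q) + t *\<^sub>R (y - p)"
        by (simp add: algebra_simps)
      have "h ((1 - t) *\<^sub>R p + t *\<^sub>R y) \<le> (1 - t) * h p + t * h y"
        using h t by (simp add: convex_on_def)
      moreover have "(norm ((p - q) + t *\<^sub>R (y - p)))\<^sup>2
          = (norm (p - q))\<^sup>2 + 2 * t * ((p - q) \<bullet> (y - p)) + t\<^sup>2 * (norm (y - p))\<^sup>2"
        unfolding power2_norm_eq_inner
        by (simp add: inner_add_left inner_add_right inner_commute power2_eq_square algebra_simps)
      ultimately have "h p + r * (norm (p - q))\<^sup>2 \<le> (1 - t) * h p + t * h y
          + r * ((norm (p - q))\<^sup>2 + 2 * t * ((p - q) \<bullet> (y - p)) + t\<^sup>2 * (norm (y - p))\<^sup>2)"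
        using min[OF conv] unfolding eq by simp
      then have "0 \<le> t * (s + t * (r * (norm (y - p))\<^sup>2))"
        by (simp add: s_def c_def algebra_simps power2_eq_square)
      with t show ?thesis by (simp add: zero_le_mult_iff)
    qed
    then have "eventually (\<lambda>t. 0 \<le> s + t * (r * (norm (y - p))\<^sup>2)) (at_right 0)"
      using eventually_at_right_real[of 0 1] by (auto elim: eventually_mono)
    moreover have "((\<lambda>t. s + t * (r * (norm (y - p))\<^sup>2)) \<longlongrightarrow> s + 0 * (r * (norm (y - p))\<^sup>2)) (at_right 0)"
      by (intro tendsto_intros)
    ultimately have "0 \<le> s"
      using tendsto_lowerbound[of _ s "at_right (0::real)" 0] by simp
    then show ?thesis by (simp add: s_def inner_diff_right)
  qed
  have "convex_on UNIV (\<lambda>y. h y + c \<bullet> y)"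
    using h by (intro convex_on_add) (auto simp: convex_on_def inner_add_right)
  then obtain g where g: "\<And>y. h y + c \<bullet> y \<ge> h p + c \<bullet> p + g \<bullet> (y - p)" "\<And>y. y \<in> C \<Longrightarrow> g \<bullet> (y - p) \<ge> 0"
    using convex_minimizer_subgradient[of "\<lambda>y. h y + c \<bullet> y" C p] C p lin by blast
  show thesis
  proof (rule that[of "g - c"])
    show "h y \<ge> h p + (g - c) \<bullet> (y - p)" for y
      using g(1)[of y] by (simp add: inner_diff_left inner_diff_right)
  qed (use g(2) in \<open>simp add: c_def[symmetric]\<close>)
qed

text \<open>An affine minorant of \<open>h\<close> is dominated by the quadratic far from
  \<open>q\<close>, so the search reduces to a compact part of \<open>C\<close>.\<close>

lemma proximal_minimizer_exists:
  fixes h :: "'a::euclidean_space \<Rightarrow> real"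
  assumes h: "convex_on UNIV h" and cont: "continuous_on UNIV h"
    and C: "closed C" "C \<noteq> {}" and r: "r > 0"
  obtains p where "p \<in> C" "\<And>y. y \<in> C \<Longrightarrow> h p + r * (norm (p - q))\<^sup>2 \<le> h y + r * (norm (y - q))\<^sup>2"
proof -
  define k where "k y = h y + r * (norm (y - q))\<^sup>2" for y
  obtain a where a: "a \<in> C" using C by auto
  \<comment> \<open>On the one-point set \<open>{q}\<close> the minimality condition is trivial, so
    what remains is a plain subgradient at \<open>q\<close>.\<close>
  obtain g where g: "\<And>y. h y \<ge> h q + g \<bullet> (y - q)"
    using convex_minimizer_subgradient[OF h, of "{q}" q] by auto
  \<comment> \<open>The first entry puts \<open>a\<close> into the ball. Beyond the other two, the
    distance \<open>n\<close> satisfies \<open>n \<ge> 1\<close> and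
    \<open>r * n - norm g \<ge> \<bar>k a - h q\<bar>\<close>, which makes \<open>k\<close> at least
    \<open>k a\<close>.\<close>
  define \<rho> where "\<rho> = max (norm (a - q)) (max 1 ((\<bar>k a - h q\<bar> + norm g) / r))"
  have far: "k a \<le> k y" if y: "norm (y - q) > \<rho>" for y
  proof -
    define n where "n = norm (y - q)"
    have n: "n \<ge> 1" "(\<bar>k a - h q\<bar> + norm g) / r \<le> n"
      using y by (auto simp: \<rho>_def n_def)
    have "\<bar>g \<bullet> (y - q)\<bar> \<le> norm g * n"
      unfolding n_def by (rule Cauchy_Schwarz_ineq2)
    then have lower: "k y \<ge> h q + n * (r * n - norm g)"
      using g[of y] by (simp add: k_def n_def[symmetric] power2_eq_square algebra_simps)
    have "\<bar>k a - h q\<bar> \<le> r * n - norm g"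
      using n r by (simp add: divide_le_eq mult.commute)
    then have "1 * \<bar>k a - h q\<bar> \<le> n * (r * n - norm g)"
      using n by (intro mult_mono) auto
    with lower show ?thesis by simp
  qed
  have "compact (C \<inter> cball q \<rho>)"
    using C by (simp add: closed_Int_compact)
  moreover have a': "a \<in> C \<inter> cball q \<rho>"
    using a by (simp add: \<rho>_def dist_norm norm_minus_commute)
  moreover have "continuous_on (C \<inter> cball q \<rho>) k"
    unfolding k_def by (intro continuous_intros continuous_on_subset[OF cont]) auto
  ultimately obtain p where p: "p \<in> C \<inter> cball q \<rho>" "\<And>y. y \<in> C \<inter> cball q \<rho> \<Longrightarrow> k p \<le> k y"
    using continuous_attains_inf[of "C \<inter> cball q \<rho>" k] by blast
  have "k p \<le> k y" if "y \<in> C" for y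
  proof (cases "norm (y - q) > \<rho>")
    case True
    with far[of y] p(2)[OF a'] show ?thesis by simp
  next
    case False
    with that p(2)[of y] show ?thesis by (simp add: dist_norm norm_minus_commute)
  qed
  with p(1) show thesis
    using that[of p] by (simp add: k_def)
qed

section \<open>Fejer monotone sequences\<close>

text \<open>An Opial-type argument in the inner product induced by \<open>P\<close>: distances to
  every point of \<open>Z\<close> decrease and increments vanish. A cluster point is therefore
  shared by the shifted subsequence, lies in \<open>Z\<close>, and is itself approached
  monotonically.\<close>

lemma fejer_proximal_point_convergent:
  fixes P :: "'a::euclidean_space \<Rightarrow> 'a" and s :: "nat \<Rightarrow> 'a"
  assumes P: "linear P" and sym: "\<And>x y. x \<bullet> P y = P x \<bullet> y"
    and c: "c > 0" and pos: "\<And>x. x \<bullet> P x \<ge> c * (norm x)\<^sup>2"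
    and Z: "Z \<noteq> {}"
    and step: "\<And>z k. z \<in> Z \<Longrightarrow> (s (Suc k) - z) \<bullet> P (s k - s (Suc k)) \<ge> 0"
    and cluster: "\<And>r l. strict_mono r \<Longrightarrow> (\<lambda>n. s (r n)) \<longlonglongrightarrow> l \<Longrightarrow> (\<lambda>n. s (Suc (r n))) \<longlonglongrightarrow> l \<Longrightarrow> l \<in> Z"
  obtains l where "l \<in> Z" "s \<longlonglongrightarrow> l"
proof -
  define Q where "Q x = x \<bullet> P x" for x
  have Q_nonneg: "Q x \<ge> 0" for x
    unfolding Q_def using c by (intro order_trans[OF _ pos]) simp
  have norm_le: "(norm x)\<^sup>2 \<le> Q x / c" for x
    using pos[of x] c by (simp add: Q_def le_divide_eq mult.commute)
  have small: "u \<longlonglongrightarrow> 0" if "(\<lambda>n. Q (u n)) \<longlonglongrightarrow> 0" for u :: "nat \<Rightarrow> 'a"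
  proof -
    have "(\<lambda>n. Q (u n) / c) \<longlonglongrightarrow> 0"
      using tendsto_divide[OF that tendsto_const[of c]] c by simp
    then have "(\<lambda>n. (norm (u n))\<^sup>2) \<longlonglongrightarrow> 0"
      by (rule tendsto_sandwich[OF _ _ tendsto_const, rotated -1]) (auto simp: norm_le)
    then have "(\<lambda>n. sqrt ((norm (u n))\<^sup>2)) \<longlonglongrightarrow> sqrt 0"
      by (rule tendsto_real_sqrt)
    then show ?thesis
      by (simp add: tendsto_norm_zero_iff)
  qed
  have Q_cont: "(\<lambda>n. Q (u n)) \<longlonglongrightarrow> Q l" if "u \<longlonglongrightarrow> l" for u :: "nat \<Rightarrow> 'a" and l
    unfolding Q_def
    by (intro tendsto_inner that bounded_linear.tendsto[of P])
      (simp_all add: P that linear_conv_bounded_linear[symmetric])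
  \<comment> \<open>In the expansion of \<open>Q (a + b)\<close> the cross term is twice the
    quantity that \<open>step\<close> makes nonnegative.\<close>
  have descent: "Q (s (Suc k) - z) \<le> Q (s k - z) - Q (s k - s (Suc k))" if "z \<in> Z" for z k
  proof -
    define a b where "a = s k - s (Suc k)" and "b = s (Suc k) - z"
    have "s k - z = a + b" by (simp add: a_def b_def)
    moreover have "Q (a + b) = Q a + Q b + 2 * (b \<bullet> P a)"
      using sym[of a b] inner_commute[of "P a" b]
      by (simp add: Q_def linear_add[OF P] inner_add_left inner_add_right)
    ultimately show ?thesis
      using step[OF that, of k] by (simp add: a_def b_def)
  qed
  have dec: "decseq (\<lambda>k. Q (s k - z))" if "z \<in> Z" for z
  proof (rule decseq_SucI)
    fix k
    show "Q (s (Suc k) - z) \<le> Q (s k - z)"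
      using descent[OF that, of k] Q_nonneg[of "s k - s (Suc k)"] by simp
  qed
  have lim: "\<exists>q. (\<lambda>k. Q (s k - z)) \<longlonglongrightarrow> q" if "z \<in> Z" for z
    by (rule decseq_convergent[OF dec[OF that], of 0]) (auto simp: Q_nonneg)
  obtain z where z: "z \<in> Z" using Z by auto
  obtain q where q: "(\<lambda>k. Q (s k - z)) \<longlonglongrightarrow> q"
    using lim[OF z] by auto
  \<comment> \<open>By the descent inequality the increment is at most the difference of consecutive
    terms of a convergent sequence.\<close>
  have "(\<lambda>k. Q (s k - s (Suc k))) \<longlonglongrightarrow> 0"
  proof (rule tendsto_sandwich[where f = "\<lambda>_. 0" and h = "\<lambda>k. Q (s k - z) - Q (s (Suc k) - z)"])
    show "\<forall>\<^sub>F k in sequentially. Q (s k - s (Suc k)) \<le> Q (s k - z) - Q (s (Suc k) - z)"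
    proof (rule always_eventually, rule allI)
      show "Q (s k - s (Suc k)) \<le> Q (s k - z) - Q (s (Suc k) - z)" for k
        using descent[OF z, of k] by simp
    qed
    show "(\<lambda>k. Q (s k - z) - Q (s (Suc k) - z)) \<longlonglongrightarrow> 0"
      using tendsto_diff[OF q LIMSEQ_Suc[OF q]] by simp
  qed (simp_all add: Q_nonneg)
  then have diff: "(\<lambda>k. s k - s (Suc k)) \<longlonglongrightarrow> 0"
    by (rule small)
  have "bounded (range s)"
  proof -
    have "norm (s k - z) \<le> sqrt (Q (s 0 - z) / c)" for k
    proof (rule real_le_rsqrt)
      have "Q (s k - z) \<le> Q (s 0 - z)"
        using dec[OF z] by (auto simp: decseq_def)
      then have "Q (s k - z) / c \<le> Q (s 0 - z) / c"
        using c by (simp add: divide_right_mono)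
      with norm_le[of "s k - z"] show "(norm (s k - z))\<^sup>2 \<le> Q (s 0 - z) / c" by simp
    qed
    then have "range s \<subseteq> cball z (sqrt (Q (s 0 - z) / c))"
      by (auto simp: dist_norm norm_minus_commute)
    then show ?thesis
      using bounded_cball bounded_subset by blast
  qed
  then obtain l r where r: "strict_mono r" and l: "(\<lambda>n. s (r n)) \<longlonglongrightarrow> l"
    using bounded_imp_convergent_subsequence[of s] by (auto simp: o_def)
  have "(\<lambda>n. s (r n) - (s (r n) - s (Suc (r n)))) \<longlonglongrightarrow> l - 0"
    using LIMSEQ_subseq_LIMSEQ[OF diff r] by (intro tendsto_diff[OF l]) (simp add: o_def)
  then have l_in: "l \<in> Z"
    using cluster[OF r l] by simp
  \<comment> \<open>As \<open>l\<close> lies in \<open>Z\<close>, the whole sequence of distances to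
    \<open>l\<close> converges, so the subsequence tending to \<open>l\<close> determines its limit
    as 0.\<close>
  obtain q' where q': "(\<lambda>k. Q (s k - l)) \<longlonglongrightarrow> q'"
    using lim[OF l_in] by auto
  have "(\<lambda>n. Q (s (r n) - l)) \<longlonglongrightarrow> q'"
    using LIMSEQ_subseq_LIMSEQ[OF q' r] by (simp add: o_def)
  moreover have "(\<lambda>n. Q (s (r n) - l)) \<longlonglongrightarrow> Q (l - l)"
    by (rule Q_cont[OF tendsto_diff[OF l tendsto_const]])
  ultimately have "q' = Q (l - l)"
    by (rule LIMSEQ_unique)
  then have "q' = 0"
    by (simp add: Q_def)
  with q' have "(\<lambda>k. s k - l) \<longlonglongrightarrow> 0"
    by (intro small) simp
  then have "s \<longlonglongrightarrow> l"
    by (simp add: LIM_zero_iff)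
  with l_in show thesis by (rule that)
qed

section \<open>Blocks of coordinates\<close>

lemma block_nth: "block own i z $ c = (if own c = i then z $ c else 0)"
  by (simp add: block_def)

lemma linear_block: "linear (block own i)"
  by (intro linearI) (auto simp: vec_eq_iff block_nth)

lemma block_in_strategy_space: "block own i z \<in> strategy_space own i"
  by (simp add: strategy_space_def block_nth)

lemma block_strategy_space: "z \<in> strategy_space own i \<Longrightarrow> block own i z = z"
  by (auto simp: strategy_space_def vec_eq_iff block_nth)

lemma inner_block: "block own i z \<bullet> w = z \<bullet> block own i w"
  unfolding inner_vec_def by (intro sum.cong) (auto simp: block_nth)

text \<open>The part of \<open>v\<close> outside block \<open>i\<close> is itself an admissible
  \<open>d\<close>, and it is orthogonal to the block part. This confines subgradients and normal
  vectors to the coordinates of one agent.\<close>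

lemma block_eq_self:
  assumes "\<And>d. block own i d = 0 \<Longrightarrow> v \<bullet> d \<le> 0"
  shows "block own i v = v"
proof -
  define d where "d = v - block own i v"
  have d: "block own i d = 0"
    by (simp add: d_def vec_eq_iff block_nth)
  have "block own i v \<bullet> d = 0"
    by (simp add: inner_block d)
  then have "d \<bullet> d \<le> 0"
    using assms[OF d] by (simp add: d_def inner_diff_left)
  then have "d = 0"
    by (metis inner_eq_zero_iff inner_ge_zero order_antisym)
  then show ?thesis by (simp add: d_def)
qed

lemma block_replace_block: "block own i (replace_block own i y z) = block own i y"
  by (auto simp: vec_eq_iff block_nth replace_block_def)

lemma replace_block_block: "replace_block own i (block own i y) z = replace_block own i y z"
  by (auto simp: vec_eq_iff block_nth replace_block_def)

lemma replace_block_self: "replace_block own i z z = z"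
  by (auto simp: vec_eq_iff replace_block_def)

lemma block_sel: "block own i (sel own x) = block own i (x $ i)"
  by (auto simp: vec_eq_iff block_nth sel_def)

lemma extended_feasible_iff: "x \<in> extended_feasible own X \<longleftrightarrow> (\<forall>i. block own i (x $ i) \<in> X i)"
  by (simp add: extended_feasible_def joint_strategies_def block_sel)

text \<open>The function sees only block \<open>i\<close> of its argument, so projecting onto the
  strategy space carries convexity to the whole space, where the minimization lemmas apply.\<close>

lemma convex_on_replace_block:
  assumes "convex_on (strategy_space own i) (\<lambda>y. h (replace_block own i y z))"
  shows "convex_on UNIV (\<lambda>y. h (replace_block own i y z))"
proof -
  have "h (replace_block own i (u *\<^sub>R x + v *\<^sub>R y) z)
      \<le> u * h (replace_block own i x z) + v * h (replace_block own i y z)"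
    if "0 \<le> u" "0 \<le> v" "u + v = 1" for u v x y
  proof -
    have "u *\<^sub>R block own i x + v *\<^sub>R block own i y = block own i (u *\<^sub>R x + v *\<^sub>R y)"
      by (simp add: linear_block linear_add linear_scale)
    then show ?thesis
      using assms that block_in_strategy_space[of own i]
      unfolding convex_on_def by (metis replace_block_block)
  qed
  then show ?thesis by (simp add: convex_on_def)
qed

lemma tendsto_replace_block [tendsto_intros]:
  assumes "(g \<longlongrightarrow> a) F" "(h \<longlongrightarrow> b) F"
  shows "((\<lambda>x. replace_block own i (g x) (h x)) \<longlongrightarrow> replace_block own i a b) F"
proof (rule vec_tendstoI)
  fix c
  show "((\<lambda>x. replace_block own i (g x) (h x) $ c) \<longlongrightarrow> replace_block own i a b $ c) F"
    using assms[THEN tendsto_vec_nth, of c] by (simp add: replace_block_def)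
qed

lemma tendsto_block [tendsto_intros]:
  "(g \<longlongrightarrow> a) F \<Longrightarrow> ((\<lambda>x. block own i (g x)) \<longlongrightarrow> block own i a) F"
  by (rule linear_continuous_at[THEN isCont_tendsto_compose])
    (simp_all add: linear_block linear_conv_bounded_linear[symmetric])

section \<open>The weight matrix\<close>

lemma linear_mix: "linear (mix W)"
  by (intro linearI) (simp_all add: mix_def vec_eq_iff scaleR_sum_right sum.distrib algebra_simps)

lemma averaged_estimates_eq: "averaged_estimates W x = (1/2) *\<^sub>R (x + mix W x)"
  by (simp add: averaged_estimates_def mix_def vec_eq_iff)

lemma inner_mix_commute:
  assumes "W = transpose W"
  shows "x \<bullet> mix W y = mix W x \<bullet> y"
proof -
  have W: "W $ i $ j = W $ j $ i" for i j
    by (subst assms) (simp add: transpose_def)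
  have "x \<bullet> mix W y = (\<Sum>i\<in>UNIV. \<Sum>j\<in>UNIV. W $ i $ j * (x $ i \<bullet> y $ j))"
    by (simp add: inner_vec_def[of x] mix_def inner_sum_right)
  also have "\<dots> = (\<Sum>j\<in>UNIV. \<Sum>i\<in>UNIV. W $ i $ j * (x $ i \<bullet> y $ j))"
    by (rule sum.swap)
  also have "\<dots> = (\<Sum>j\<in>UNIV. \<Sum>i\<in>UNIV. W $ j $ i * (x $ i \<bullet> y $ j))"
    by (simp only: W)
  also have "\<dots> = mix W x \<bullet> y"
    by (simp add: inner_vec_def[of _ y] mix_def inner_sum_left)
  finally show ?thesis .
qed

lemma weight_matrix_row_sum:
  assumes "weight_matrix E W"
  shows "(\<Sum>j\<in>UNIV. W $ i $ j) = 1"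
proof -
  have "(W *v 1) $ i = 1"
    using assms by (simp add: weight_matrix_def)
  then show ?thesis by (simp add: matrix_vector_mult_def)
qed

lemma weight_matrix_column_sum:
  assumes "weight_matrix E W"
  shows "(\<Sum>i\<in>UNIV. W $ i $ j) = 1"
proof -
  have "(1 v* W) $ j = 1"
    using assms by (simp add: weight_matrix_def)
  then show ?thesis by (simp add: vector_matrix_mult_def)
qed

lemma weight_matrix_nonneg: "weight_matrix E W \<Longrightarrow> W $ i $ j \<ge> 0"
  unfolding weight_matrix_def by (metis less_imp_le order_refl)

lemma mix_const:
  assumes "weight_matrix E W"
  shows "mix W (\<chi> i. x) = (\<chi> i. x)"
  using weight_matrix_row_sum[OF assms] by (simp add: mix_def vec_eq_iff flip: sum_distrib_right)

lemma sum_mix: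
  assumes "weight_matrix E W"
  shows "(\<Sum>i\<in>UNIV. mix W x $ i) = (\<Sum>i\<in>UNIV. x $ i)"
proof -
  have "(\<Sum>i\<in>UNIV. mix W x $ i) = (\<Sum>j\<in>UNIV. \<Sum>i\<in>UNIV. W $ i $ j *\<^sub>R x $ j)"
    unfolding mix_def by (simp, rule sum.swap)
  also have "\<dots> = (\<Sum>j\<in>UNIV. (\<Sum>i\<in>UNIV. W $ i $ j) *\<^sub>R x $ j)"
    by (simp add: scaleR_sum_left)
  finally show ?thesis
    by (simp add: weight_matrix_column_sum[OF assms])
qed

text \<open>Unit row and column sums supply the two square terms. The sign
  \<open>\<sigma> = 1\<close> serves the positivity of \<open>I + W\<close>;
  \<open>\<sigma> = -1\<close> gives the graph Laplacian form of \<open>I - W\<close>.\<close>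

lemma mix_sum_of_squares:
  assumes W: "weight_matrix E W" and \<sigma>: "\<sigma>\<^sup>2 = (1::real)"
  shows "2 * (x \<bullet> (x + \<sigma> *\<^sub>R mix W x)) = (\<Sum>i\<in>UNIV. \<Sum>j\<in>UNIV. W $ i $ j * (norm (x $ i + \<sigma> *\<^sub>R x $ j))\<^sup>2)"
proof -
  have "(\<Sum>i\<in>UNIV. \<Sum>j\<in>UNIV. W $ i $ j * (norm (x $ i + \<sigma> *\<^sub>R x $ j))\<^sup>2)
      = (\<Sum>i\<in>UNIV. \<Sum>j\<in>UNIV. W $ i $ j * (x $ i \<bullet> x $ i) + W $ i $ j * (x $ j \<bullet> x $ j)
          + 2 * \<sigma> * (W $ i $ j * (x $ i \<bullet> x $ j)))"
  proof (intro sum.cong refl)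
    fix i j
    have "(norm (x $ i + \<sigma> *\<^sub>R x $ j))\<^sup>2 = x $ i \<bullet> x $ i + \<sigma>\<^sup>2 * (x $ j \<bullet> x $ j) + 2 * \<sigma> * (x $ i \<bullet> x $ j)"
      unfolding power2_norm_eq_inner
      by (simp add: inner_add_left inner_add_right inner_commute power2_eq_square)
    then show "W $ i $ j * (norm (x $ i + \<sigma> *\<^sub>R x $ j))\<^sup>2
        = W $ i $ j * (x $ i \<bullet> x $ i) + W $ i $ j * (x $ j \<bullet> x $ j) + 2 * \<sigma> * (W $ i $ j * (x $ i \<bullet> x $ j))"
      by (simp add: \<sigma> algebra_simps)
  qed
  also have "\<dots> = (\<Sum>i\<in>UNIV. (\<Sum>j\<in>UNIV. W $ i $ j) * (x $ i \<bullet> x $ i))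
      + (\<Sum>j\<in>UNIV. (\<Sum>i\<in>UNIV. W $ i $ j) * (x $ j \<bullet> x $ j))
      + 2 * \<sigma> * (\<Sum>i\<in>UNIV. \<Sum>j\<in>UNIV. W $ i $ j * (x $ i \<bullet> x $ j))"
    using sum.swap[of "\<lambda>i j. W $ i $ j * (x $ j \<bullet> x $ j)" UNIV UNIV]
    by (simp add: sum.distrib sum_distrib_left sum_distrib_right)
  also have "\<dots> = 2 * (x \<bullet> (x + \<sigma> *\<^sub>R mix W x))"
    by (simp add: weight_matrix_row_sum[OF W] weight_matrix_column_sum[OF W] inner_add_right
        inner_vec_def[of x] mix_def inner_sum_right sum.distrib sum_distrib_left algebra_simps)
  finally show ?thesis by simp
qed

text \<open>In the sum of squares with \<open>\<sigma> = 1\<close> the diagonal terms alone equal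
  \<open>4 * W $ i $ i * (norm (x $ i))\<^sup>2\<close>; the others are nonnegative. This explains
  the constant \<open>2 * Min\<close>.\<close>

lemma preconditioner_positive:
  assumes W: "weight_matrix E W"
  obtains c where "c > 0" "\<And>x :: (real ^ 'd) ^ 'i::finite. x \<bullet> (x + mix W x) \<ge> c * (norm x)\<^sup>2"
proof
  define c where "c = 2 * Min (range (\<lambda>i. W $ i $ i))"
  show "c > 0"
    using W by (simp add: c_def weight_matrix_def)
  fix x :: "(real ^ 'd) ^ 'i"
  have "(norm x)\<^sup>2 = (\<Sum>i\<in>UNIV. (norm (x $ i))\<^sup>2)"
    by (simp add: power2_norm_eq_inner inner_vec_def[of x])
  then have "2 * (c * (norm x)\<^sup>2) = (\<Sum>i\<in>UNIV. 2 * c * (norm (x $ i))\<^sup>2)"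
    by (simp add: sum_distrib_left mult.assoc)
  also have "\<dots> \<le> (\<Sum>i\<in>UNIV. W $ i $ i * (norm (x $ i + 1 *\<^sub>R x $ i))\<^sup>2)"
  proof (intro sum_mono)
    fix i
    have "c \<le> 2 * W $ i $ i" by (simp add: c_def)
    then have "2 * c * (norm (x $ i))\<^sup>2 \<le> 2 * (2 * W $ i $ i) * (norm (x $ i))\<^sup>2"
      by (intro mult_right_mono) auto
    moreover have "norm (x $ i + 1 *\<^sub>R x $ i) = 2 * norm (x $ i)"
      by (simp flip: scaleR_2)
    ultimately show "2 * c * (norm (x $ i))\<^sup>2 \<le> W $ i $ i * (norm (x $ i + 1 *\<^sub>R x $ i))\<^sup>2"
      by (simp add: power_mult_distrib)
  qed
  also have "\<dots> \<le> (\<Sum>i\<in>UNIV. \<Sum>j\<in>UNIV. W $ i $ j * (norm (x $ i + 1 *\<^sub>R x $ j))\<^sup>2)"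
    by (intro sum_mono member_le_sum) (auto simp: weight_matrix_nonneg[OF W])
  also have "\<dots> = 2 * (x \<bullet> (x + mix W x))"
    using mix_sum_of_squares[OF W, of 1 x] by simp
  finally show "x \<bullet> (x + mix W x) \<ge> c * (norm x)\<^sup>2" by simp
qed

text \<open>The Laplacian form vanishes at a fixed point, so estimates agree across every edge and,
  by connectivity, everywhere.\<close>

lemma mix_fixed_point_const:
  assumes W: "weight_matrix E W" and E: "undirected_connected E" and fix_x: "mix W x = x"
  obtains \<xi> where "x = (\<chi> i. \<xi>)"
proof -
  have nonneg: "0 \<le> W $ i $ j * (norm (x $ i + (-1) *\<^sub>R x $ j))\<^sup>2" for i j
    by (simp add: weight_matrix_nonneg[OF W])
  have "(\<Sum>i\<in>UNIV. \<Sum>j\<in>UNIV. W $ i $ j * (norm (x $ i + (-1) *\<^sub>R x $ j))\<^sup>2) = 0"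
    using mix_sum_of_squares[OF W, of "-1" x] fix_x by simp
  then have zero: "W $ i $ j * (norm (x $ i + (-1) *\<^sub>R x $ j))\<^sup>2 = 0" for i j
    using nonneg by (simp add: sum_nonneg_eq_0_iff sum_nonneg)
  have edge: "x $ i = x $ j" if "(i, j) \<in> E" for i j
  proof (cases "i = j")
    case False
    then have "W $ i $ j > 0"
      using that W by (simp add: weight_matrix_def)
    with zero[of i j] show ?thesis by simp
  qed simp
  have "x $ i = x $ j" if "(i, j) \<in> E\<^sup>*" for i j
    using that by induction (auto dest: edge)
  then have "x = (\<chi> i. x $ undefined)"
    using E by (simp add: undirected_connected_def vec_eq_iff)
  then show thesis by (rule that)
qed

section \<open>Best responses\<close>

text \<open>
  The graph of the step map without reference to \<^const>\<open>arg_min\<close>, which makes it evident that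
  the graph is closed.
\<close>

definition best_response ::
  "('d::finite \<Rightarrow> 'i::finite) \<Rightarrow> ('i \<Rightarrow> (real ^ 'd) set) \<Rightarrow> ('i \<Rightarrow> real ^ 'd \<Rightarrow> real) \<Rightarrow> real ^ 'i ^ 'i \<Rightarrow> real
     \<Rightarrow> (real ^ 'd) ^ 'i \<Rightarrow> (real ^ 'd) ^ 'i \<Rightarrow> bool" where
  "best_response own X f W \<alpha> x y \<longleftrightarrow>
     (let z = averaged_estimates W x in
      \<forall>i. y $ i = replace_block own i (y $ i) (z $ i) \<and> block own i (y $ i) \<in> X i \<and>
        (\<forall>w\<in>X i. f i (y $ i) + (1/\<alpha>) * (norm (block own i (y $ i) - block own i (z $ i)))\<^sup>2
           \<le> f i (replace_block own i w (z $ i)) + (1/\<alpha>) * (norm (w - block own i (z $ i)))\<^sup>2))"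

text \<open>For a fixed competitor \<open>w\<close> both sides of the optimality inequality are
  continuous in the pair of estimates, and the remaining clauses are closed. Passing to the limit in
  the relation avoids any continuity argument for the minimizer.\<close>

lemma best_response_limit:
  assumes X: "\<And>i. closed (X i)" and f: "\<And>i. continuous_on UNIV (f i)"
    and x: "x \<longlonglongrightarrow> a" and y: "y \<longlonglongrightarrow> b"
    and br: "\<And>n. best_response own X f W \<alpha> (x n) (y n)"
  shows "best_response own X f W \<alpha> a b"
proof -
  define z where "z n = averaged_estimates W (x n)" for n
  define c where "c = averaged_estimates W a"
  have "z \<longlonglongrightarrow> c"
    unfolding z_def c_def averaged_estimates_eq
    by (intro tendsto_intros x bounded_linear.tendsto[of "mix W"])
      (simp_all add: x linear_mix linear_conv_bounded_linear[symmetric])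
  then have z: "(\<lambda>n. z n $ i) \<longlonglongrightarrow> c $ i" for i by (rule tendsto_vec_nth)
  have y: "(\<lambda>n. y n $ i) \<longlonglongrightarrow> b $ i" for i using y by (rule tendsto_vec_nth)
  have f_lim: "(\<lambda>n. f i (u n)) \<longlonglongrightarrow> f i l" if "u \<longlonglongrightarrow> l" for i u l
    using continuous_on_tendsto_compose[OF f that] by simp
  have br: "y n $ i = replace_block own i (y n $ i) (z n $ i)" "block own i (y n $ i) \<in> X i"
    "\<And>w. w \<in> X i \<Longrightarrow> f i (y n $ i) + (1/\<alpha>) * (norm (block own i (y n $ i) - block own i (z n $ i)))\<^sup>2
       \<le> f i (replace_block own i w (z n $ i)) + (1/\<alpha>) * (norm (w - block own i (z n $ i)))\<^sup>2" for n i
    using br[of n] by (auto simp: best_response_def Let_def z_def[symmetric])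
  have "b $ i = replace_block own i (b $ i) (c $ i)" for i
  proof (rule LIMSEQ_unique[OF y])
    have "(\<lambda>n. replace_block own i (y n $ i) (z n $ i)) = (\<lambda>n. y n $ i)"
      by (rule ext) (rule br(1)[symmetric])
    then show "(\<lambda>n. y n $ i) \<longlonglongrightarrow> replace_block own i (b $ i) (c $ i)"
      using tendsto_replace_block[OF y[of i] z[of i], of own i] by metis
  qed
  moreover have "block own i (b $ i) \<in> X i" for i
    by (rule closed_sequentially[OF X _ tendsto_block[OF y]]) (simp add: br(2))
  moreover have "f i (b $ i) + (1/\<alpha>) * (norm (block own i (b $ i) - block own i (c $ i)))\<^sup>2
       \<le> f i (replace_block own i w (c $ i)) + (1/\<alpha>) * (norm (w - block own i (c $ i)))\<^sup>2"
    if w: "w \<in> X i" for i w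
  proof (rule LIMSEQ_le)
    show "(\<lambda>n. f i (y n $ i) + (1/\<alpha>) * (norm (block own i (y n $ i) - block own i (z n $ i)))\<^sup>2)
        \<longlonglongrightarrow> f i (b $ i) + (1/\<alpha>) * (norm (block own i (b $ i) - block own i (c $ i)))\<^sup>2"
      by (intro tendsto_intros f_lim y z)
    show "(\<lambda>n. f i (replace_block own i w (z n $ i)) + (1/\<alpha>) * (norm (w - block own i (z n $ i)))\<^sup>2)
        \<longlonglongrightarrow> f i (replace_block own i w (c $ i)) + (1/\<alpha>) * (norm (w - block own i (c $ i)))\<^sup>2"
      by (intro tendsto_intros f_lim z)
    show "\<exists>N. \<forall>n\<ge>N. f i (y n $ i) + (1/\<alpha>) * (norm (block own i (y n $ i) - block own i (z n $ i)))\<^sup>2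
        \<le> f i (replace_block own i w (z n $ i)) + (1/\<alpha>) * (norm (w - block own i (z n $ i)))\<^sup>2"
      by (intro exI allI impI br(3)[OF w])
  qed
  ultimately show ?thesis
    unfolding best_response_def Let_def c_def[symmetric] by blast
qed

section \<open>One step of the iteration as an inclusion for the game operator\<close>

locale nash_game =
  fixes own :: "'d::finite \<Rightarrow> 'i::finite"
    and X :: "'i \<Rightarrow> (real ^ 'd) set"
    and f :: "'i \<Rightarrow> real ^ 'd \<Rightarrow> real"
    and E :: "('i \<times> 'i) set"
    and W :: "real ^ 'i ^ 'i"
    and \<alpha> :: real
  assumes X_subset: "\<And>i. X i \<subseteq> strategy_space own i" and X_nonempty: "\<And>i. X i \<noteq> {}"
    and X_closed: "\<And>i. closed (X i)" and X_convex: "\<And>i. convex (X i)"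
    and f_cont: "\<And>i. continuous_on UNIV (f i)"
    and f_convex: "\<And>i z. convex_on (strategy_space own i) (\<lambda>y. f i (replace_block own i y z))"
    and graph: "undirected_connected E"
    and weights: "weight_matrix E W"
    and \<alpha>_pos: "\<alpha> > 0"
begin

lemma block_X: "w \<in> X i \<Longrightarrow> block own i w = w"
  by (intro block_strategy_space subsetD[OF X_subset])

lemma best_response_nash_step: "best_response own X f W \<alpha> x (nash_step own X f W \<alpha> x)"
proof -
  define z where "z = averaged_estimates W x"
  define y where "y = nash_step own X f W \<alpha> x"
  define obj where
    "obj i = (\<lambda>w. f i (replace_block own i w (z $ i)) + (1/\<alpha>) * (norm (w - block own i (z $ i)))\<^sup>2)" for i
  define p where "p i = arg_min (obj i) (\<lambda>w. w \<in> X i)" for i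
  have y: "y $ i = replace_block own i (p i) (z $ i)" for i
    by (simp add: y_def nash_step_def Let_def p_def obj_def z_def)
  have p: "p i \<in> X i \<and> (\<forall>w\<in>X i. obj i (p i) \<le> obj i w)" for i
  proof -
    have "continuous_on UNIV (\<lambda>w. f i (replace_block own i w (z $ i)))"
    proof (rule continuous_on_compose2[OF f_cont])
      show "continuous_on UNIV (\<lambda>w. replace_block own i w (z $ i))"
        unfolding continuous_on_def
        by (intro ballI tendsto_replace_block tendsto_ident_at tendsto_const)
    qed simp
    then obtain q where "q \<in> X i" "\<And>w. w \<in> X i \<Longrightarrow> obj i q \<le> obj i w"
      using proximal_minimizer_exists[OF convex_on_replace_block[OF f_convex[of i "z $ i"]] _ X_closed[of i] X_nonempty[of i], of "1/\<alpha>"]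
        \<alpha>_pos unfolding obj_def by (metis zero_less_divide_1_iff)
    then have "is_arg_min (obj i) (\<lambda>w. w \<in> X i) q"
      by (auto simp: is_arg_min_def not_less)
    \<comment> \<open>\<open>arg_min\<close> is a choice operator, so one existing minimizer makes
      its value a minimizer.\<close>
    then have "is_arg_min (obj i) (\<lambda>w. w \<in> X i) (p i)"
      unfolding p_def arg_min_def by (rule someI)
    then show ?thesis
      by (auto simp: is_arg_min_def not_less)
  qed
  have "block own i (y $ i) = p i" for i
    using p[of i] by (simp add: y block_replace_block block_X)
  moreover have "y $ i = replace_block own i (y $ i) (z $ i)" for i
    by (simp add: y vec_eq_iff replace_block_def)
  ultimately show ?thesis
    using p unfolding best_response_def Let_def z_def[symmetric] y_def[symmetric] obj_def
    by (metis y)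
qed

text \<open>The optimality condition of each agent, scaled by \<open>- \<alpha>\<close>, is a normal
  vector. The weight \<open>1/\<alpha>\<close> and the factor 1/2 in the averaging are matched so
  that the gradient of the quadratic becomes \<open>2 (z - y) = x + W x - 2 y\<close>.\<close>

lemma best_response_A_op:
  assumes br: "best_response own X f W \<alpha> x y"
  shows "(x - y) + mix W (x - y) \<in> A_op own X f W \<alpha> y"
proof -
  define z where "z = averaged_estimates W x"
  define p where "p i = block own i (y $ i)" for i
  define q where "q i = block own i (z $ i)" for i
  have y: "y $ i = replace_block own i (y $ i) (z $ i)" and p: "p i \<in> X i"
    and min: "\<And>w. w \<in> X i \<Longrightarrow> f i (y $ i) + (1/\<alpha>) * (norm (p i - q i))\<^sup>2
       \<le> f i (replace_block own i w (z $ i)) + (1/\<alpha>) * (norm (w - q i))\<^sup>2" for i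
    using br by (auto simp: best_response_def z_def p_def q_def Let_def)
  have y_p: "replace_block own i (p i) (z $ i) = y $ i" for i
    using y[of i] by (simp add: p_def replace_block_block)
  \<comment> \<open>Outside block \<open>i\<close> the new estimates of agent \<open>i\<close> are
    the averaged ones, so the subdifferential at \<open>y\<close> is that of the function minimized
    in the step.\<close>
  have yz: "replace_block own i w (y $ i) = replace_block own i w (z $ i)" for i w
    by (subst y) (simp add: vec_eq_iff replace_block_def)
  have "\<exists>g. (\<forall>w. f i (replace_block own i w (z $ i)) \<ge> f i (y $ i) + g \<bullet> (w - p i)) \<and>
      (\<forall>w\<in>X i. (g + (2 * (1/\<alpha>)) *\<^sub>R (p i - q i)) \<bullet> (w - p i) \<ge> 0)" for i
    using proximal_minimizer_subgradient[OF convex_on_replace_block[OF f_convex[of i "z $ i"]] X_convex[of i] p[of i], of "1/\<alpha>" "q i"]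
      min[of _ i] unfolding y_p by metis
  then obtain g where g: "\<And>i w. f i (replace_block own i w (z $ i)) \<ge> f i (y $ i) + g i \<bullet> (w - p i)"
    and g_X: "\<And>i w. w \<in> X i \<Longrightarrow> (g i + (2 * (1/\<alpha>)) *\<^sub>R (p i - q i)) \<bullet> (w - p i) \<ge> 0"
    by metis
  \<comment> \<open>Moving in a direction with zero block \<open>i\<close> leaves the cost
    unchanged, so a subgradient has no component there.\<close>
  have g_block: "block own i (g i) = g i" for i
  proof (rule block_eq_self)
    fix d assume d: "block own i d = 0"
    have "block own i (p i + d) = block own i (p i)"
      by (simp add: linear_add[OF linear_block] d)
    then have "replace_block own i (p i + d) (z $ i) = y $ i"
      using y_p[of i] by (metis replace_block_block)
    then show "g i \<bullet> d \<le> 0"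
      using g[of i "p i + d"] by simp
  qed
  \<comment> \<open>The subgradients of all agents are glued by taking each coordinate from its
    owner.\<close>
  define u :: "real ^ 'd" where "u = (\<chi> c. g (own c) $ c)"
  have u: "block own i u = g i" for i
  proof -
    have "block own i u = block own i (g i)"
      by (auto simp: u_def vec_eq_iff block_nth)
    then show ?thesis by (simp add: g_block)
  qed
  have u_in: "u \<in> extended_game_map own f y"
    using g block_in_strategy_space[of own _ u]
    by (auto simp: extended_game_map_def subdifferential_on_def u yz y_p p_def[symmetric])
  \<comment> \<open>The residual that the inclusion demands; its terms in \<open>mix W y\<close>
    cancel.\<close>
  define v where "v = ((x - y) + mix W (x - y)) - (\<alpha> *\<^sub>R sel_transpose own u + (y - mix W y))"
  have v: "v $ i = (- \<alpha>) *\<^sub>R (g i + (2 * (1/\<alpha>)) *\<^sub>R (p i - q i))" for i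
  proof -
    have "v = 2 *\<^sub>R z - 2 *\<^sub>R y - \<alpha> *\<^sub>R sel_transpose own u"
      by (simp add: v_def z_def averaged_estimates_eq linear_diff[OF linear_mix] scaleR_2)
    moreover have "z $ i - y $ i = q i - p i"
      by (subst y) (auto simp: vec_eq_iff replace_block_def q_def p_def block_nth)
    then have "2 *\<^sub>R z $ i - 2 *\<^sub>R y $ i = 2 *\<^sub>R (q i - p i)"
      by (simp flip: scaleR_diff_right)
    ultimately have "v $ i = 2 *\<^sub>R (q i - p i) - \<alpha> *\<^sub>R g i"
      by (simp add: sel_transpose_def u)
    then show ?thesis
      using \<alpha>_pos by (simp add: algebra_simps)
  qed
  have "v \<in> normal_cone (extended_feasible own X) y"
  proof -
    have "v \<bullet> (w - y) \<le> 0" if w: "w \<in> extended_feasible own X" for w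
    proof -
      \<comment> \<open>The extended feasible set is a product over agents and \<open>v $ i\<close>
        lives on block \<open>i\<close>, so the inequality can be tested agent by agent on own
        strategies.\<close>
      have "v $ i \<bullet> (w $ i - y $ i) \<le> 0" for i
      proof -
        have "block own i (v $ i) = v $ i"
          by (simp add: v linear_block linear_add linear_scale linear_diff linear_neg g_block p_def q_def)
            (simp add: vec_eq_iff block_nth)
        then have "v $ i \<bullet> (w $ i - y $ i) = v $ i \<bullet> (block own i (w $ i) - p i)"
          using inner_block[of own i "v $ i" "w $ i - y $ i"] by (simp add: linear_diff[OF linear_block] p_def)
        also have "\<dots> \<le> 0"
        proof -
          have "block own i (w $ i) \<in> X i"
            using w by (simp add: extended_feasible_iff)
          from g_X[OF this] show ?thesis
            unfolding v inner_scaleR_left using \<alpha>_pos by (simp add: mult_nonneg_nonneg)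
        qed
        finally show ?thesis .
      qed
      then show ?thesis
        by (simp add: inner_vec_def[of v] sum_nonpos)
    qed
    moreover have "y \<in> extended_feasible own X"
      using p by (simp add: extended_feasible_iff p_def)
    ultimately show ?thesis by (simp add: normal_cone_def)
  qed
  moreover have "(x - y) + mix W (x - y) = (\<alpha> *\<^sub>R sel_transpose own u + (y - mix W y)) + v"
    by (simp add: v_def)
  ultimately show ?thesis
    unfolding A_op_def F_op_def using u_in by blast
qed

section \<open>Zeros of the operator and consensual Nash equilibria\<close>

lemma nash_equilibrium_zer:
  assumes "nash_equilibrium own X f x"
  shows "(\<chi> i. x) \<in> zer (A_op own X f W \<alpha>)"
proof -
  have z: "averaged_estimates W (\<chi> i. x) = (\<chi> i. x)"
    by (simp add: averaged_estimates_eq mix_const[OF weights] vec_eq_iff)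
  \<comment> \<open>Averaging leaves consensus unchanged, and the proximal term vanishes at the own
    strategy, so an equilibrium is its own best response. The inclusion for one step then has left
    side 0.\<close>
  have "best_response own X f W \<alpha> (\<chi> i. x) (\<chi> i. x)"
    unfolding best_response_def z Let_def
  proof (intro allI conjI ballI)
    fix i w assume w: "w \<in> X i"
    have "f i x \<le> f i (replace_block own i w x)"
      using assms w by (auto simp: nash_equilibrium_def is_arg_min_def not_less replace_block_block replace_block_self)
    moreover have "0 \<le> (1/\<alpha>) * (norm (w - block own i x))\<^sup>2"
      using \<alpha>_pos by simp
    ultimately show "f i ((\<chi> i. x) $ i) + (1/\<alpha>) * (norm (block own i ((\<chi> i. x) $ i) - block own i ((\<chi> i. x) $ i)))\<^sup>2
        \<le> f i (replace_block own i w ((\<chi> i. x) $ i)) + (1/\<alpha>) * (norm (w - block own i ((\<chi> i. x) $ i)))\<^sup>2"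
      by simp
  qed (use assms in \<open>simp_all add: replace_block_self nash_equilibrium_def joint_strategies_def\<close>)
  from best_response_A_op[OF this] show ?thesis
    by (simp add: zer_def linear_0[OF linear_mix])
qed

text \<open>The game and normal parts of agent \<open>i\<close> are supported on block
  \<open>i\<close>, whereas the consensus part sums to zero over the agents. Disjoint supports force
  both to vanish separately, leaving consensus and the first-order equilibrium conditions.\<close>

lemma zer_nash_equilibrium:
  assumes "x \<in> zer (A_op own X f W \<alpha>)"
  obtains \<xi> where "x = (\<chi> i. \<xi>)" "nash_equilibrium own X f \<xi>"
proof -
  obtain u v where u: "u \<in> extended_game_map own f x"
    and v: "v \<in> normal_cone (extended_feasible own X) x"
    and zero: "0 = (\<alpha> *\<^sub>R sel_transpose own u + (x - mix W x)) + v"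
    using assms by (auto simp: zer_def A_op_def F_op_def)
  have x: "x \<in> extended_feasible own X"
    using v by (auto simp: normal_cone_def split: if_splits)
  \<comment> \<open>Only the estimates of agent \<open>i\<close> are perturbed; in the coordinates
    of other agents \<open>d\<close> is unrestricted, which confines \<open>v $ i\<close> to block
    \<open>i\<close>.\<close>
  have normal: "v $ i \<bullet> d \<le> 0" if d: "block own i (x $ i + d) \<in> X i" for i d
  proof -
    have "x + axis i d \<in> extended_feasible own X"
      using x d by (auto simp: extended_feasible_iff axis_def)
    then have "v \<bullet> axis i d \<le> 0"
      using v x by (auto simp: normal_cone_def dest: bspec)
    then show ?thesis by (simp add: inner_axis)
  qed
  have v_block: "block own i (v $ i) = v $ i" for i
    by (intro block_eq_self normal) (use x in \<open>simp add: linear_add[OF linear_block] extended_feasible_iff\<close>)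
  define s where "s i = \<alpha> *\<^sub>R block own i u + v $ i" for i
  have s: "s i = mix W x $ i - x $ i" for i
  proof -
    have "0 = (\<alpha> *\<^sub>R sel_transpose own u + (x - mix W x) + v) $ i"
      by (simp flip: zero)
    then show ?thesis
      by (simp add: s_def sel_transpose_def algebra_simps)
  qed
  have s_block: "block own i (s i) = s i" for i
    by (auto simp: s_def linear_add[OF linear_block] v_block) (auto simp: vec_eq_iff block_nth)
  have sum_s: "(\<Sum>i\<in>UNIV. s i) = 0"
    by (simp add: s sum_subtractf sum_mix[OF weights])
  have "s i = 0" for i
  proof -
    have "s i $ c = 0" for c
    proof (cases "own c = i")
      case True
      \<comment> \<open>At coordinate \<open>c\<close> only its owner contributes to the vanishing
        sum.\<close>
      have entry: "s j $ c = (if j = i then s i $ c else 0)" for j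
        using s_block[of j] True by (metis block_nth)
      have "(\<Sum>j\<in>UNIV. s j $ c) = (\<Sum>j\<in>UNIV. if j = i then s i $ c else 0)"
        by (rule sum.cong[OF refl entry])
      then have "(\<Sum>j\<in>UNIV. s j $ c) = s i $ c" by simp
      then show ?thesis
        using sum_s by (metis sum_component zero_index)
    next
      case False
      then show ?thesis
        using s_block[of i] by (metis block_nth)
    qed
    then show ?thesis by (simp add: vec_eq_iff)
  qed
  then have "mix W x = x" and v_eq: "\<And>i. v $ i = - (\<alpha> *\<^sub>R block own i u)"
    using s by (auto simp: vec_eq_iff s_def add_eq_0_iff)
  then obtain \<xi> where \<xi>: "x = (\<chi> i. \<xi>)"
    using mix_fixed_point_const[OF weights graph] by metis
  \<comment> \<open>With \<open>v $ i\<close> equal to minus \<open>\<alpha>\<close> times the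
    subgradient, normality gives the subgradient a nonnegative product with every feasible
    direction.\<close>
  have "f i \<xi> \<le> f i (replace_block own i w \<xi>)" if w: "w \<in> X i" for i w
  proof -
    have "v $ i \<bullet> (w - block own i \<xi>) \<le> 0"
    proof (rule normal)
      have "block own i (x $ i + (w - block own i \<xi>)) = block own i w"
        by (auto simp: \<xi> vec_eq_iff block_nth)
      with w show "block own i (x $ i + (w - block own i \<xi>)) \<in> X i"
        by (simp add: block_X)
    qed
    then have "block own i u \<bullet> (w - block own i \<xi>) \<ge> 0"
      using \<alpha>_pos by (simp add: v_eq zero_le_mult_iff)
    moreover have "w \<in> strategy_space own i"
      using w X_subset by auto
    then have "f i (replace_block own i w \<xi>)
        \<ge> f i (replace_block own i (block own i \<xi>) \<xi>) + block own i u \<bullet> (w - block own i \<xi>)"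
      using u by (simp add: extended_game_map_def subdifferential_on_def \<xi>)
    ultimately show ?thesis
      by (simp add: replace_block_block replace_block_self)
  qed
  then have "nash_equilibrium own X f \<xi>"
    using x by (auto simp: nash_equilibrium_def joint_strategies_def extended_feasible_iff \<xi>
        is_arg_min_def not_less replace_block_block replace_block_self)
  with \<xi> show thesis by (rule that)
qed

section \<open>Convergence of the iteration\<close>

lemma restricted_monotone_A_op:
  assumes mono: "restricted_monotone (F_op own f W \<alpha>) (zer (A_op own X f W \<alpha>))"
    and z: "z \<in> zer (A_op own X f W \<alpha>)" and b: "b \<in> A_op own X f W \<alpha> y"
  shows "(y - z) \<bullet> b \<ge> 0"
proof -
  obtain a v where a: "a \<in> F_op own f W \<alpha> y" "v \<in> normal_cone (extended_feasible own X) y" "b = a + v"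
    using b by (auto simp: A_op_def)
  obtain a' v' where a': "a' \<in> F_op own f W \<alpha> z" "v' \<in> normal_cone (extended_feasible own X) z" "a' + v' = 0"
    using z by (auto simp: A_op_def zer_def)
  \<comment> \<open>This is combined with the monotonicity of the normal cone; since
    \<open>a' + v' = 0\<close>, only the product with \<open>b\<close> remains.\<close>
  have "(y - z) \<bullet> (a - a') \<ge> 0"
    using mono z a(1) a'(1) by (auto simp: restricted_monotone_def)
  moreover have "v \<bullet> (z - y) \<le> 0" "v' \<bullet> (y - z) \<le> 0"
    using a(2) a'(2) by (auto simp: normal_cone_def split: if_splits)
  moreover have "a' = - v'"
    using a'(3) by (simp add: eq_neg_iff_add_eq_0)
  ultimately show ?thesis
    by (simp add: a(3) inner_diff_left inner_diff_right inner_add_right inner_commute)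
qed

lemma nash_step_convergent:
  assumes mono: "restricted_monotone (F_op own f W \<alpha>) (zer (A_op own X f W \<alpha>))"
    and existence: "\<exists>x. nash_equilibrium own X f x"
  shows "\<exists>x. nash_equilibrium own X f x \<and> (\<lambda>k. (nash_step own X f W \<alpha> ^^ k) x0) \<longlonglongrightarrow> (\<chi> i. x)"
proof -
  define s where "s k = (nash_step own X f W \<alpha> ^^ k) x0" for k
  define P :: "(real ^ 'd) ^ 'i \<Rightarrow> (real ^ 'd) ^ 'i" where "P x = x + mix W x" for x
  have br: "best_response own X f W \<alpha> (s k) (s (Suc k))" for k
    by (simp add: s_def best_response_nash_step)
  obtain c where c: "c > 0" "\<And>x :: (real ^ 'd) ^ 'i. x \<bullet> P x \<ge> c * (norm x)\<^sup>2"
    using preconditioner_positive[OF weights] unfolding P_def by metis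
  have "W = transpose W"
    using weights by (simp add: weight_matrix_def)
  then have sym: "x \<bullet> P y = P x \<bullet> y" for x y
    by (simp add: P_def inner_add_left inner_add_right inner_mix_commute)
  have lin: "linear P"
    unfolding P_def by (intro linear_compose_add linear_mix linear_ident)
  have "zer (A_op own X f W \<alpha>) \<noteq> {}"
    using existence nash_equilibrium_zer by blast
  moreover have "(s (Suc k) - z) \<bullet> P (s k - s (Suc k)) \<ge> 0" if "z \<in> zer (A_op own X f W \<alpha>)" for z k
    using restricted_monotone_A_op[OF mono that best_response_A_op[OF br]] by (simp add: P_def)
  \<comment> \<open>Consecutive iterates with a common limit make \<open>l\<close> its own best
    response, so the one-step inclusion at \<open>l\<close> has left side 0.\<close>
  moreover have "l \<in> zer (A_op own X f W \<alpha>)"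
    if "(\<lambda>n. s (r n)) \<longlonglongrightarrow> l" "(\<lambda>n. s (Suc (r n))) \<longlonglongrightarrow> l" for r l
    using best_response_A_op[OF best_response_limit[OF X_closed f_cont that br]]
    by (simp add: zer_def linear_0[OF linear_mix])
  ultimately obtain l where l: "l \<in> zer (A_op own X f W \<alpha>)" "s \<longlonglongrightarrow> l"
    using fejer_proximal_point_convergent[OF lin sym c, of "zer (A_op own X f W \<alpha>)" s] by blast
  obtain \<xi> where "l = (\<chi> i. \<xi>)" "nash_equilibrium own X f \<xi>"
    using zer_nash_equilibrium[OF l(1)] .
  with l(2) show ?thesis
    unfolding s_def by blast
qed

end

theorem theorem1:
  fixes own :: "'d::finite \<Rightarrow> 'i::finite"
    and X :: "'i \<Rightarrow> (real ^ 'd) set"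
    and f :: "'i \<Rightarrow> real ^ 'd \<Rightarrow> real"
    and E :: "('i \<times> 'i) set"
    and W :: "real ^ 'i ^ 'i"
    and \<alpha> :: real
    and x0 :: "(real ^ 'd) ^ 'i"
  assumes X: "\<And>i. X i \<subseteq> strategy_space own i" "\<And>i. X i \<noteq> {}" "\<And>i. closed (X i)" "\<And>i. convex (X i)"
    and f_cont: "\<And>i. continuous_on UNIV (f i)"
    and f_convex: "\<And>i z. convex_on (strategy_space own i) (\<lambda>y. f i (replace_block own i y z))"
    and existence: "\<exists>x. nash_equilibrium own X f x"
    and graph: "undirected_connected E"
    and weights: "weight_matrix E W"
    and "\<alpha> > 0"
    and monotone: "restricted_monotone (F_op own f W \<alpha>) (zer (A_op own X f W \<alpha>))"
  shows "\<exists>x. nash_equilibrium own X f x \<and>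
           (\<lambda>k. (nash_step own X f W \<alpha> ^^ k) x0) \<longlonglongrightarrow> (\<chi> i. x)"
proof -
  interpret nash_game own X f E W \<alpha>
    by unfold_locales (fact assms)+
  show ?thesis
    using monotone existence by (rule nash_step_convergent)
qed

end
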